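(* Let $\nu$ be a real number with $0<\nu<1$. Then \[ \int_{0}^{\infty}\frac{1}{x}\,\sinh(x)\,e^{-x}\left(\frac{e^{-x}-2\cos(2\nu\pi)}{\cosh(x)-\cos(2\nu\pi)}\right)dx=\log(4\pi)-\psi(1)+\psi(\nu)+\frac{\pi}{2}\cot(\nu\pi). \]
   Context: $\psi(z)=\Gamma'(z)/\Gamma(z)$ denotes the digamma function and $\log$ the real natural logarithm. *)

theory Defs
  imports "HOL-Analysis.Analysis"
begin

end

(*
  Partial fractions, obtained as the imaginary part of the reflection formula for the digamma function,
  give sinh x / (x (cosh x - cos (2 pi nu))) as a sum of terms 2 / (x^2 + (2 pi (k + nu))^2) over all
  integers k. Termwise integration then determines, up to a constant independent of nu, how the
  integral depends on nu. The constant is found at nu = 1/2, where the integrand is a series of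
  Frullani integrands exp (-n x) - exp (-(n+1) x) over x, and Wallis' product yields ln pi.
*)

theory Submission
  imports Defs
begin

section \<open>The reflection formula for the digamma function\<close>

text \<open>Differentiate \<open>rGamma z * rGamma (1 - z)\<close> twice: by the product rule, and
  as sin (pi z) / pi through Euler's reflection formula. The reciprocal Gamma function is entire, so
  the derivatives involve no poles.\<close>

lemma Digamma_reflection_complex:
  fixes z :: complex
  assumes "z \<notin> \<int>"
  shows "of_real pi * cos (of_real pi * z) / sin (of_real pi * z) = Digamma (1 - z) - Digamma z"
proof -
  have z: "z \<notin> \<int>\<^sub>\<le>\<^sub>0" "1 - z \<notin> \<int>\<^sub>\<le>\<^sub>0"
    using assms nonpos_Ints_Int Ints_diff[OF Ints_1, of "1 - z"] by auto
  have "((\<lambda>w. rGamma w * rGamma (1 - w)) has_field_derivative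
      rGamma z * rGamma (1 - z) * (Digamma (1 - z) - Digamma z)) (at z)"
    using z by (auto intro!: derivative_eq_intros simp: algebra_simps)
  moreover have "((\<lambda>w. rGamma w * rGamma (1 - w)) has_field_derivative cos (of_real pi * z)) (at z)"
    unfolding rGamma_reflection_complex by (auto intro!: derivative_eq_intros)
  ultimately have "cos (of_real pi * z) = rGamma z * rGamma (1 - z) * (Digamma (1 - z) - Digamma z)"
    by (rule DERIV_unique[symmetric])
  moreover have "sin (of_real pi * z) \<noteq> 0"
    using rGamma_reflection_complex[of z] z by (auto simp: rGamma_eq_zero_iff)
  ultimately show ?thesis
    unfolding rGamma_reflection_complex by simp
qed

lemma Digamma_reflection_real:
  fixes x :: real
  assumes "x \<notin> \<int>"
  shows "pi * cot (pi * x) = Digamma (1 - x) - Digamma x"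
proof -
  have "x \<noteq> 0" "1 - x \<noteq> 0"
    using assms by auto
  then have [simp]: "Digamma (complex_of_real x) = of_real (Digamma x)"
    "Digamma (1 - complex_of_real x) = of_real (Digamma (1 - x))"
    using Polygamma_of_real[of "1 - x" 0, where 'a = complex] by (simp_all add: Polygamma_of_real)
  have "complex_of_real x \<notin> \<int>"
    using assms by (auto elim!: Ints_cases simp: complex_eq_iff)
  from Digamma_reflection_complex[OF this]
  have "complex_of_real (pi * cot (pi * x)) = of_real (Digamma (1 - x) - Digamma x)"
    by (simp add: cot_def cos_of_real sin_of_real flip: of_real_mult)
  then show ?thesis
    by (simp only: of_real_eq_iff)
qed

lemma Digamma_sums:
  fixes z :: "'a :: {real_normed_field, banach}"
  assumes "z \<noteq> 0"
  shows "(\<lambda>k. inverse (of_nat (Suc k)) - inverse (z + of_nat k)) sums (Digamma z + euler_mascheroni)"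
  using summable_sums[OF summable_Digamma[OF assms]] by (simp add: Digamma_def)

section \<open>Partial fractions from the imaginary part of the cotangent\<close>

text \<open>Multiply numerator and denominator by the conjugate of sin z and apply the double-angle
  formulas; the denominator is |sin z|^2 = (cosh (2 Im z) - cos (2 Re z)) / 2. Where sin z = 0 both
  sides are 0, by the convention for division by zero.\<close>

lemma Im_cot:
  "Im (cos z / sin z) = - sinh (2 * Im z) / (cosh (2 * Im z) - cos (2 * Re z))"
proof -
  let ?a = "Re z" and ?b = "Im z"
  have re: "Re (sin z) = sin ?a * cosh ?b" "Im (sin z) = cos ?a * sinh ?b"
    "Re (cos z) = cos ?a * cosh ?b" "Im (cos z) = - sin ?a * sinh ?b"
    by (auto simp: Re_sin Im_sin Re_cos Im_cos cosh_def sinh_def field_simps)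
  have c: "(cosh ?b)\<^sup>2 = 1 + (sinh ?b)\<^sup>2" "(cos ?a)\<^sup>2 = 1 - (sin ?a)\<^sup>2"
    by (simp_all add: cosh_square_eq cos_squared_eq)
  have n: "(Re (sin z))\<^sup>2 + (Im (sin z))\<^sup>2 = (cosh (2 * ?b) - cos (2 * ?a)) / 2"
    unfolding re cosh_double cos_double power_mult_distrib c by (simp add: algebra_simps)
  have m: "Im (cos z) * Re (sin z) - Re (cos z) * Im (sin z) = - sinh (2 * ?b) / 2"
  proof -
    have "Im (cos z) * Re (sin z) - Re (cos z) * Im (sin z)
        = - (sinh ?b * cosh ?b) * ((sin ?a)\<^sup>2 + (cos ?a)\<^sup>2)"
      unfolding re by algebra
    then show ?thesis by (simp add: sinh_double)
  qed
  show ?thesis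
    unfolding Im_divide n m by simp
qed

lemma sinh_over_cosh_minus_cos_sums:
  fixes \<nu> x :: real
  assumes \<nu>: "0 < \<nu>" "\<nu> < 1" and x: "x > 0"
  shows "(\<lambda>k. 2 / (x\<^sup>2 + (2 * pi * (real k + \<nu>))\<^sup>2) + 2 / (x\<^sup>2 + (2 * pi * (real k + 1 - \<nu>))\<^sup>2)) sums
    (sinh x / (x * (cosh x - cos (2 * \<nu> * pi))))"
proof -
  \<comment> \<open>This scaling makes the imaginary part of 2 pi z equal to x, so that
    \<open>Im_cot\<close> produces sinh x and cosh x.\<close>
  define y where "y = x / (2 * pi)"
  define z where "z = Complex \<nu> y"
  have y: "y > 0" using x by (simp add: y_def)
  have zi: "z \<notin> \<int>"
    using y by (auto simp: z_def elim!: Ints_cases dest: arg_cong[of _ _ Im])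
  have "z \<noteq> 0" "1 - z \<noteq> 0" using zi by auto
  \<comment> \<open>The harmonic terms and the Euler-Mascheroni constants cancel in the
    difference.\<close>
  from sums_diff[OF Digamma_sums[OF this(2)] Digamma_sums[OF this(1)]]
  have "(\<lambda>k. inverse (z + of_nat k) - inverse (1 - z + of_nat k)) sums (Digamma (1 - z) - Digamma z)"
    by simp
  then have "(\<lambda>k. Im (inverse (z + of_nat k) - inverse (1 - z + of_nat k)))
      sums Im (Digamma (1 - z) - Digamma z)"
    by (rule sums_Im)
  moreover have "Im (inverse (z + of_nat k) - inverse (1 - z + of_nat k)) =
      - pi * x * (2 / (x\<^sup>2 + (2 * pi * (real k + \<nu>))\<^sup>2) + 2 / (x\<^sup>2 + (2 * pi * (real k + 1 - \<nu>))\<^sup>2))"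
    for k :: nat
  proof -
    have *: "y / (t\<^sup>2 + y\<^sup>2) = pi * x * (2 / (x\<^sup>2 + (2 * pi * t)\<^sup>2))" for t
    proof -
      have "t\<^sup>2 + y\<^sup>2 = (x\<^sup>2 + (2 * pi * t)\<^sup>2) / (2 * pi)\<^sup>2"
        by (simp add: y_def field_simps)
      then show ?thesis
        by (simp add: y_def field_simps power2_eq_square)
    qed
    show ?thesis
      using *[of "real k + \<nu>"] *[of "real k + 1 - \<nu>"]
      by (simp add: z_def algebra_simps)
  qed
  moreover have "Im (Digamma (1 - z) - Digamma z) = - pi * x * (sinh x / (x * (cosh x - cos (2 * \<nu> * pi))))"
  proof -
    have "Im (of_real pi * (cos (of_real pi * z) / sin (of_real pi * z)))
        = - pi * (sinh (2 * (pi * y)) / (cosh (2 * (pi * y)) - cos (2 * (pi * \<nu>))))"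
    proof -
      have im: "Im (of_real pi * w) = pi * Im w" for w
        by simp
      show ?thesis
        unfolding im Im_cot by (simp add: z_def)
    qed
    then show ?thesis
      using Digamma_reflection_complex[OF zi] x by (simp add: y_def mult_ac)
  qed
  \<comment> \<open>Both the terms and the sum carry the nonzero factor - pi x, which is then
    cancelled.\<close>
  ultimately have "(\<lambda>k. - pi * x * (2 / (x\<^sup>2 + (2 * pi * (real k + \<nu>))\<^sup>2) + 2 / (x\<^sup>2 + (2 * pi * (real k + 1 - \<nu>))\<^sup>2)))
      sums (- pi * x * (sinh x / (x * (cosh x - cos (2 * \<nu> * pi)))))"
    by simp
  then show ?thesis
    using x by (subst (asm) sums_mult_iff) auto
qed

section \<open>Termwise integration and two explicit integrals\<close>

text \<open>Nonnegative terms make the partial sums increase, so monotone convergence applies. Both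
  series of integrands below are integrated this way.\<close>

lemma has_integral_sums_nonneg:
  fixes f :: "nat \<Rightarrow> 'a::euclidean_space \<Rightarrow> real"
  assumes "\<And>k. (f k has_integral c k) S"
    and "\<And>k x. x \<in> S \<Longrightarrow> 0 \<le> f k x"
    and "\<And>x. x \<in> S \<Longrightarrow> (\<lambda>k. f k x) sums g x"
    and "c sums C"
  shows "(g has_integral C) S"
proof (rule has_integral_monotone_convergence_increasing)
  show "((\<lambda>x. \<Sum>i<k. f i x) has_integral (\<Sum>i<k. c i)) S" for k
    by (intro has_integral_sum assms) auto
qed (use assms in \<open>auto simp: sums_def\<close>)

lemma has_integral_Ioi_iff_Ici:
  fixes f :: "real \<Rightarrow> real"
  shows "(f has_integral c) {a<..} \<longleftrightarrow> (f has_integral c) {a..}"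
proof (rule has_integral_spike_set_eq)
  show "negligible {x \<in> {a<..} - {a..}. f x \<noteq> 0}" "negligible {x \<in> {a..} - {a<..}. f x \<noteq> 0}"
    by (rule negligible_subset[OF negligible_sing[of a]], force)+
qed

text \<open>The antiderivative (2 / a) arctan (x / a) vanishes at 0 and tends to pi / a.\<close>

lemma has_integral_inverse_square_plus_square:
  fixes a :: real
  assumes "a > 0"
  shows "((\<lambda>x. 2 / (x\<^sup>2 + a\<^sup>2)) has_integral pi / a) {0<..}"
  unfolding has_integral_Ioi_iff_Ici
proof (rule has_integral_to_inf)
  have nz: "x\<^sup>2 + a\<^sup>2 \<noteq> 0" for x
    using assms by (simp add: sum_power2_eq_zero_iff)
  have i: "((\<lambda>x. 2 / (x\<^sup>2 + a\<^sup>2)) has_integral 2 / a * arctan (y / a) - 2 / a * arctan (0 / a)) {0..y}"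
    if "y \<ge> 0" for y
    using that assms nz
    by (intro fundamental_theorem_of_calculus)
       (auto intro!: derivative_eq_intros simp: field_simps power2_eq_square add_nonneg_eq_0_iff
             simp flip: has_real_derivative_iff_has_vector_derivative)
  show "(\<lambda>x. 2 / (x\<^sup>2 + a\<^sup>2)) integrable_on {0..y}" for y
    using nz by (intro integrable_continuous_interval continuous_intros) auto
  have "((\<lambda>y. 2 / a * arctan (y / a)) \<longlongrightarrow> 2 / a * (pi / 2)) at_top"
    using assms
    by (intro tendsto_intros filterlim_compose[OF tendsto_arctan_at_top]
        filterlim_at_top_mult_tendsto_pos[OF tendsto_const, of "inverse a", simplified, folded divide_inverse])
       (auto simp: filterlim_ident divide_inverse)
  moreover have "eventually (\<lambda>y. 2 / a * arctan (y / a) = integral {0..y} (\<lambda>x. 2 / (x\<^sup>2 + a\<^sup>2))) at_top"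
    using eventually_ge_at_top[of 0] by eventually_elim (use integral_unique[OF i] in simp)
  ultimately show "((\<lambda>y. integral {0..y} (\<lambda>x. 2 / (x\<^sup>2 + a\<^sup>2))) \<longlongrightarrow> pi / a) at_top"
    by (simp add: tendsto_cong)
qed auto

text \<open>The integrand is the integral of exp (- t x) over t from a to b. Exchanging the order of
  integration, which nonnegativity permits, leaves the integral of 1 / t.\<close>

lemma Frullani_exp:
  fixes a b :: real
  assumes "0 < a" "a \<le> b"
  shows "((\<lambda>x. (exp (- a * x) - exp (- b * x)) / x) has_integral ln (b / a)) {0<..}"
proof -
  define f where "f = (\<lambda>x::real. indicator {0<..} x * ((exp (- a * x) - exp (- b * x)) / x))"
  have f0: "0 \<le> f x" for x
    using assms by (auto simp: f_def indicator_def intro!: divide_nonneg_pos)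
  have [measurable]: "f \<in> borel_measurable borel"
    unfolding f_def by measurable
  have "(\<integral>\<^sup>+x. ennreal (f x) \<partial>lborel) =
      (\<integral>\<^sup>+x. (\<integral>\<^sup>+t. ennreal (exp (- t * x)) * indicator {a..b} t * indicator {0..} x \<partial>lborel) \<partial>lborel)"
  \<comment> \<open>The point x = 0 is excluded: \<open>f\<close> is 0 there, while the inner
    integral is b - a.\<close>
  proof (rule nn_integral_cong_AE)
    have "ennreal (f x) = (\<integral>\<^sup>+t. ennreal (exp (- t * x)) * indicator {a..b} t * indicator {0..} x \<partial>lborel)"
      if "x \<noteq> 0" for x
    proof (cases "x > 0")
      case True
      have "(\<integral>\<^sup>+t. ennreal (exp (- t * x)) * indicator {a..b} t \<partial>lborel)
          = ennreal (- exp (- b * x) / x - (- exp (- a * x) / x))"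
        using True assms by (intro nn_integral_FTC_Icc) (auto intro!: derivative_eq_intros)
      then show ?thesis
        using True by (simp add: f_def diff_divide_distrib)
    qed (use that in \<open>auto simp: f_def\<close>)
    then show "AE x in lborel. ennreal (f x) =
        (\<integral>\<^sup>+t. ennreal (exp (- t * x)) * indicator {a..b} t * indicator {0..} x \<partial>lborel)"
      using AE_lborel_singleton[of "0::real"] by (auto elim: eventually_mono)
  qed
  also have "\<dots> = (\<integral>\<^sup>+t. (\<integral>\<^sup>+x. ennreal (exp (- t * x)) * indicator {a..b} t * indicator {0..} x \<partial>lborel) \<partial>lborel)"
    by (rule lborel_pair.Fubini'[symmetric]) measurable
  also have "\<dots> = (\<integral>\<^sup>+t. ennreal (1 / t) * indicator {a..b} t \<partial>lborel)"
  proof (rule nn_integral_cong)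
    fix t :: real
    show "(\<integral>\<^sup>+x. ennreal (exp (- t * x)) * indicator {a..b} t * indicator {0..} x \<partial>lborel)
        = ennreal (1 / t) * indicator {a..b} t"
    proof (cases "t \<in> {a..b}")
      case True
      have "(\<integral>\<^sup>+x. ennreal (exp (- t * x)) * indicator {0..} x \<partial>lborel) = ennreal (0 - (- exp (- t * 0) / t))"
      proof (rule nn_integral_FTC_atLeast)
        have "((\<lambda>x. exp (- (t * x))) \<longlongrightarrow> 0) at_top"
          using True assms
          by (intro filterlim_compose[OF exp_at_bot] filterlim_uminus_at_bot_at_top[THEN filterlim_compose]
              filterlim_tendsto_pos_mult_at_top[OF tendsto_const] filterlim_ident) auto
        then show "((\<lambda>x. - exp (- t * x) / t) \<longlongrightarrow> 0) at_top"
          using tendsto_divide[OF tendsto_minus tendsto_const, of _ 0 at_top t] True assms by auto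
      qed (use True assms in \<open>auto intro!: derivative_eq_intros\<close>)
      then show ?thesis
        using True by (simp add: mult.commute)
    qed auto
  qed
  also have "\<dots> = ennreal (ln b - ln a)"
    using assms by (intro nn_integral_FTC_Icc) (auto intro!: derivative_eq_intros)
  also have "ln b - ln a = ln (b / a)"
    using assms by (simp add: ln_div)
  finally have "integral\<^sup>N lborel f = ennreal (ln (b / a))" .
  then have "(f has_integral ln (b / a)) UNIV"
    using assms by (subst has_integral_iff_nn_integral_lebesgue[OF f0]) (auto intro!: measurable_completion simp: nn_integral_completion)
  then have "((\<lambda>x. if x \<in> {0<..} then (exp (- a * x) - exp (- b * x)) / x else 0) has_integral ln (b / a)) UNIV"
    by (rule has_integral_eq[rotated]) (auto simp: f_def)
  then show ?thesis
    by (simp only: has_integral_restrict_UNIV)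
qed

section \<open>The constant at \<nu> = 1/2 by Frullani integrals and Wallis' product\<close>

text \<open>With q = exp (-x), the integrand splits into (q - q^2) / x, which contributes ln 2, and
  q (1 - q) / (x (1 + q)), an alternating series of Frullani integrands contributing ln (pi /
  2).\<close>

lemma has_integral_cosh_cos_half:
  "((\<lambda>x. (1 - exp (- 2 * x)) / x - sinh x / (x * (cosh x + 1))) has_integral ln pi) {0<..}"
proof -
  define fr where "fr = (\<lambda>n x::real. (exp (- real n * x) - exp (- real (Suc n) * x)) / x)"
  have fr: "(fr n has_integral ln (Suc n / n)) {0<..}" if "n > 0" for n
    unfolding fr_def using that by (intro Frullani_exp) auto
  \<comment> \<open>Consecutive terms of the alternating series are paired so that each summand is
    nonnegative, as monotone convergence requires.\<close>
  define h where "h = (\<lambda>m x. fr (2 * m + 1) x - fr (2 * m + 2) x)"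
  have h_eq: "h m x = exp (-x) * (1 - exp (-x))\<^sup>2 / x * (exp (- x) ^ 2) ^ m" for m x
  proof -
    have "exp (- real n * x) = exp (- x) ^ n" for n
      by (metis exp_of_nat_mult mult_minus_right mult_minus_left)
    then show ?thesis
      by (simp only: h_def fr_def)
        (simp add: power_add power_mult power2_eq_square field_simps diff_divide_distrib add_divide_distrib)
  qed
  let ?w = "\<lambda>k::nat. 4 * real k ^ 2 / (4 * real k ^ 2 - 1)"
  have "((\<lambda>x. exp (-x) * (1 - exp (-x)) / (x * (1 + exp (-x)))) has_integral ln (pi / 2)) {0<..}"
  proof (rule has_integral_sums_nonneg)
    \<comment> \<open>The pair with index m gives the Wallis factor (2m+2)^2 / ((2m+1)(2m+3));
      Wallis' product starts at k = 1, hence the shift.\<close>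
    show "(h m has_integral ln (?w (Suc m))) {0<..}" for m
    proof -
      have "(h m has_integral ln (Suc (2 * m + 1) / (2 * m + 1)) - ln (Suc (2 * m + 2) / (2 * m + 2))) {0<..}"
        unfolding h_def using fr[of "2 * m + 1"] fr[of "2 * m + 2"]
        by (intro has_integral_diff) auto
      also have "ln (Suc (2 * m + 1) / (2 * m + 1)) - ln (Suc (2 * m + 2) / (2 * m + 2)) =
          ln ((Suc (2 * m + 1) / (2 * m + 1)) / (Suc (2 * m + 2) / (2 * m + 2)))"
        by (subst ln_div) auto
      also have "(Suc (2 * m + 1) / (2 * m + 1)) / (Suc (2 * m + 2) / (2 * m + 2)) = ?w (Suc m)"
      proof -
        have "4 * real (Suc m) ^ 2 - 1 = (2 * m + 1) * (2 * m + 3)"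
          "4 * real (Suc m) ^ 2 = (2 * m + 2) * (2 * m + 2)"
          by (simp_all add: power2_eq_square algebra_simps)
        then show ?thesis by (simp add: algebra_simps)
      qed
      finally show ?thesis .
    qed
    show "0 \<le> h m x" if "x \<in> {0<..}" for m x
      using that by (simp add: h_eq)
    show "(\<lambda>m. h m x) sums (exp (-x) * (1 - exp (-x)) / (x * (1 + exp (-x))))" if "x \<in> {0<..}" for x
    proof -
      let ?q = "exp (-x)"
      have q: "?q < 1" "?q > 0" using that by auto
      have "(\<lambda>m. h m x) sums (?q * (1 - ?q)\<^sup>2 / x * (1 / (1 - ?q ^ 2)))"
        unfolding h_eq using q that by (intro sums_mult geometric_sums) (auto simp: power_less_one_iff)
      also have "?q * (1 - ?q)\<^sup>2 / x * (1 / (1 - ?q ^ 2)) = ?q * (1 - ?q) / (x * (1 + ?q))"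
      proof -
        have "1 - ?q ^ 2 = (1 - ?q) * (1 + ?q)" by (simp add: power2_eq_square algebra_simps)
        then show ?thesis using q by (simp add: power2_eq_square)
      qed
      finally show ?thesis .
    qed
    have pos: "?w k > 0" if "k \<ge> 1" for k
    proof -
      have "real k ^ 2 \<ge> 1" using that by (intro one_le_power) auto
      then show ?thesis by (intro divide_pos_pos) linarith+
    qed
    have "(\<lambda>n. ln (\<Prod>k=1..n. ?w k)) \<longlonglongrightarrow> ln (pi / 2)"
      by (intro tendsto_ln wallis) auto
    also have "(\<lambda>n. ln (\<Prod>k=1..n. ?w k)) = (\<lambda>n. \<Sum>k<n. ln (?w (Suc k)))"
    proof
      fix n
      have "ln (\<Prod>k=1..n. ?w k) = (\<Sum>k=1..n. ln (?w k))"
        by (rule ln_prod) (use pos in \<open>fastforce simp only: atLeastAtMost_iff finite_atLeastAtMost\<close>)+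
      also have "\<dots> = (\<Sum>k<n. ln (?w (Suc k)))"
        by (rule sum.reindex_bij_witness[of _ Suc "\<lambda>k. k - 1"]) auto
      finally show "ln (\<Prod>k=1..n. ?w k) = (\<Sum>k<n. ln (?w (Suc k)))" .
    qed
    finally show "(\<lambda>m. ln (?w (Suc m))) sums ln (pi / 2)"
      by (simp add: sums_def)
  qed
  from has_integral_add[OF fr[of 1] this]
  have "((\<lambda>x. fr 1 x + exp (-x) * (1 - exp (-x)) / (x * (1 + exp (-x)))) has_integral
      ln 2 + ln (pi / 2)) {0<..}" by simp
  also have "ln 2 + ln (pi / 2) = ln pi"
    by (simp add: ln_div)
  finally show ?thesis
  proof (rule has_integral_eq[rotated])
    fix x :: real assume x: "x \<in> {0<..}"
    define q where "q = exp (-x)"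
    have q: "0 < q" "exp x = inverse q" "exp (-2 * x) = q * q"
      by (simp_all add: q_def exp_minus[of x, symmetric] mult_exp_exp) (simp add: exp_minus)
    have "sinh x / (cosh x + 1) = (1 - q) / (1 + q)"
    proof -
      have "sinh x = (1 - q) * (1 + q) / (2 * q)" "cosh x + 1 = (1 + q) * (1 + q) / (2 * q)"
        using q by (simp_all add: sinh_field_def cosh_field_def field_simps flip: q_def)
      moreover have "1 + q \<noteq> 0" using q by simp
      ultimately show ?thesis using q by simp
    qed
    then have "sinh x / (x * (cosh x + 1)) = (1 - q) / (1 + q) / x"
      by (metis divide_divide_eq_left mult.commute)
    \<comment> \<open>This rational identity in q is the splitting of the integrand.\<close>
    moreover have "q - q * q + q * (1 - q) / (1 + q) = 1 - q * q - (1 - q) / (1 + q)"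
      using q by (simp add: field_simps)
    then have "(q - q * q) / x + q * (1 - q) / (1 + q) / x = (1 - q * q) / x - (1 - q) / (1 + q) / x"
      by (metis add_divide_distrib diff_divide_distrib)
    ultimately show "fr 1 x + exp (-x) * (1 - exp (-x)) / (x * (1 + exp (-x))) =
        (1 - exp (-2 * x)) / x - sinh x / (x * (cosh x + 1))"
      using q by (simp add: fr_def mult.commute flip: q_def)
  qed
qed

section \<open>The dependence of the integral on \<nu>\<close>

text \<open>The subtracted series keeps the terms of the partial fraction expansion nonnegative while making
  the series of their integrals converge.\<close>

lemma has_integral_sinh_over_cosh_minus_cos:
  fixes \<nu> :: real
  assumes \<nu>: "0 < \<nu>" "\<nu> < 1"
  shows "((\<lambda>x. sinh x / (x * (cosh x - cos (2 * \<nu> * pi))) - (\<Sum>k. 4 / (x\<^sup>2 + (2 * pi * (real k + 1))\<^sup>2)))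
    has_integral (- euler_mascheroni - (Digamma \<nu> + Digamma (1 - \<nu>)) / 2)) {0<..}"
proof -
  let ?t = "\<lambda>a x. 2 / (x\<^sup>2 + (2 * pi * a)\<^sup>2)"
  have t: "(?t a has_integral inverse a / 2) {0<..}" if "a > 0" for a
    using has_integral_inverse_square_plus_square[of "2 * pi * a"] that by (simp add: field_simps)
  have mono: "?t b x \<le> ?t a x" if "0 < a" "a \<le> b" for a b x
  proof -
    have "0 < x\<^sup>2 + (2 * pi * a)\<^sup>2"
      using that by (intro add_nonneg_pos) auto
    moreover have "(2 * pi * a)\<^sup>2 \<le> (2 * pi * b)\<^sup>2"
      using that by (intro power_mono) auto
    ultimately show ?thesis
      by (intro divide_left_mono mult_pos_pos) auto
  qed
  \<comment> \<open>Since \<nu> and 1 - \<nu> are at most 1, both partial fraction terms dominate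
    the subtracted one; this gives nonnegativity and also the summability of the subtracted
    series.\<close>
  have le: "?t (real k + 1) x \<le> ?t (real k + \<nu>) x" "?t (real k + 1) x \<le> ?t (real k + 1 - \<nu>) x" for k :: nat and x
    using \<nu> by (auto intro!: mono)
  show ?thesis
  proof (rule has_integral_sums_nonneg)
    show "((\<lambda>x. ?t (real k + \<nu>) x + ?t (real k + 1 - \<nu>) x - 2 * ?t (real k + 1) x) has_integral
        (inverse (real k + \<nu>) / 2 + inverse (real k + 1 - \<nu>) / 2 - 2 * (inverse (real k + 1) / 2))) {0<..}" for k :: nat
      using \<nu> by (intro has_integral_add has_integral_diff has_integral_mult_right t) auto
    show "0 \<le> ?t (real k + \<nu>) x + ?t (real k + 1 - \<nu>) x - 2 * ?t (real k + 1) x" for k :: nat and x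
      using le[of x k] by linarith
    show "(\<lambda>k. ?t (real k + \<nu>) x + ?t (real k + 1 - \<nu>) x - 2 * ?t (real k + 1) x) sums
        (sinh x / (x * (cosh x - cos (2 * \<nu> * pi))) - (\<Sum>k. 4 / (x\<^sup>2 + (2 * pi * (real k + 1))\<^sup>2)))"
      if "x \<in> {0<..}" for x
    proof -
      note P = sinh_over_cosh_minus_cos_sums[OF \<nu>, of x]
      have "summable (\<lambda>k. 4 / (x\<^sup>2 + (2 * pi * (real k + 1))\<^sup>2))"
      proof (rule summable_comparison_test'[OF sums_summable[OF P]])
        show "norm (4 / (x\<^sup>2 + (2 * pi * (real k + 1))\<^sup>2)) \<le> ?t (real k + \<nu>) x + ?t (real k + 1 - \<nu>) x" for k
        proof -
          have "norm (4 / (x\<^sup>2 + (2 * pi * (real k + 1))\<^sup>2)) = 2 * ?t (real k + 1) x"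
            by simp
          then show ?thesis
            using le[of x k] by linarith
        qed
      qed (use that in auto)
      from sums_diff[OF P summable_sums[OF this]] that show ?thesis by simp
    qed
    \<comment> \<open>The termwise integrals are -1/2 times the sum of the terms of the digamma
      series at \<nu> and at 1 - \<nu>.\<close>
    have "(\<lambda>k. - 1 / 2 * (inverse (of_nat (Suc k)) - inverse (\<nu> + of_nat k) +
        (inverse (of_nat (Suc k)) - inverse (1 - \<nu> + of_nat k)))) sums
        (- 1 / 2 * (Digamma \<nu> + euler_mascheroni + (Digamma (1 - \<nu>) + euler_mascheroni)))"
      using \<nu> by (intro sums_mult sums_add Digamma_sums) auto
    then show "(\<lambda>k. inverse (real k + \<nu>) / 2 + inverse (real k + 1 - \<nu>) / 2 - 2 * (inverse (real k + 1) / 2)) sums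
        (- euler_mascheroni - (Digamma \<nu> + Digamma (1 - \<nu>)) / 2)"
      by (simp add: algebra_simps add_divide_distrib diff_divide_distrib)
  qed
qed

section \<open>Comparison with \<nu> = 1/2 and evaluation of the constants\<close>

theorem theorem2:
  fixes \<nu> :: real
  assumes "0 < \<nu>" and "\<nu> < 1"
  shows "((\<lambda>x::real. 1 / x * sinh x * exp (- x) *
            ((exp (- x) - 2 * cos (2 * \<nu> * pi)) / (cosh x - cos (2 * \<nu> * pi))))
          has_integral
          (ln (4 * pi) - Digamma 1 + Digamma \<nu> + pi / 2 * cot (\<nu> * pi))) {0<..}"
proof -
  let ?c = "cos (2 * \<nu> * pi)"
  let ?P = "\<lambda>c x. sinh x / (x * (cosh x - c))"
  \<comment> \<open>This series does not depend on \<nu>, so it cancels between the given \<nu> and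
    1/2.\<close>
  let ?T = "\<lambda>x. \<Sum>k. 4 / (x\<^sup>2 + (2 * pi * (real k + 1))\<^sup>2)"
  let ?A = "\<lambda>x. (1 - exp (- 2 * x)) / x"
  have half: "((\<lambda>x. ?P (- 1) x - ?T x) has_integral - euler_mascheroni - Digamma (1 / 2)) {0<..}"
    using has_integral_sinh_over_cosh_minus_cos[of "1 / 2"] by simp
  have base: "((\<lambda>x. ?A x - ?P (- 1) x) has_integral ln pi) {0<..}"
    using has_integral_cosh_cos_half by simp
  \<comment> \<open>The sum collapses to \<open>?A x - ?P ?c x\<close>. Each of \<open>?A\<close>,
    \<open>?P\<close> and \<open>?T\<close> decays only like 1 / x, so only differences are
    integrated.\<close>
  have main: "((\<lambda>x. ?A x - ?P (- 1) x + (?P (- 1) x - ?T x) - (?P ?c x - ?T x)) has_integral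
      ln pi + (- euler_mascheroni - Digamma (1 / 2)) -
      (- euler_mascheroni - (Digamma \<nu> + Digamma (1 - \<nu>)) / 2)) {0<..}"
    by (intro has_integral_add has_integral_diff base half has_integral_sinh_over_cosh_minus_cos assms)
  have eq: "?A x - ?P (- 1) x + (?P (- 1) x - ?T x) - (?P ?c x - ?T x) =
      1 / x * sinh x * exp (- x) * ((exp (- x) - 2 * ?c) / (cosh x - ?c))" if "x \<in> {0<..}" for x
  proof -
    define q where "q = exp (- x)"
    define c where "c = ?c"
    have q: "0 < q" "exp x = inverse q" "exp (-2 * x) = q * q"
      by (simp_all add: q_def exp_minus[of x, symmetric] mult_exp_exp) (simp add: exp_minus)
    have sc: "sinh x = (1 - q * q) / (2 * q)" "cosh x - c = (1 - 2 * c * q + q * q) / (2 * q)"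
      using q by (simp_all add: sinh_field_def cosh_field_def field_simps flip: q_def)
    have "1 < cosh x"
      using that cosh_real_strict_mono[of 0 x] by simp
    then have d: "cosh x - c \<noteq> 0"
      using cos_le_one[of "2 * \<nu> * pi"] unfolding c_def by linarith
    \<comment> \<open>N equals 2 q (cosh x - c). Hence 1 - q^2 is N times the quotient sinh x /
      (cosh x - c), and subtracting that quotient leaves the factor N - 1 = q (q - 2 c) of the
      target integrand.\<close>
    define N where "N = 1 - 2 * c * q + q * q"
    have "N \<noteq> 0"
      using sc d by (auto simp: N_def)
    have "sinh x / (cosh x - c) = (1 - q * q) / N"
      unfolding sc N_def using q by simp
    then have 1: "1 - q * q = N * (sinh x / (cosh x - c))"
      using \<open>N \<noteq> 0\<close> by simp
    have 2: "sinh x * q * ((q - 2 * c) / (cosh x - c)) = (N - 1) * (sinh x / (cosh x - c))"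
    proof -
      have "N - 1 = q * (q - 2 * c)"
        by (simp add: N_def algebra_simps)
      then show ?thesis by simp
    qed
    have "(1 - q * q) - sinh x / (cosh x - c) = sinh x * q * ((q - 2 * c) / (cosh x - c))"
      unfolding 1 2 by (simp only: left_diff_distrib mult_1)
    then have "((1 - q * q) - sinh x / (cosh x - c)) / x = sinh x * q * ((q - 2 * c) / (cosh x - c)) / x"
      by simp
    then show ?thesis
      unfolding q_def[symmetric] c_def[symmetric] using q
      by (simp add: diff_divide_distrib mult.commute)
  qed
  \<comment> \<open>The value Digamma (1/2) = - euler_mascheroni - 2 ln 2 turns ln pi into ln (4
    pi), and Digamma 1 = - euler_mascheroni absorbs the remaining constant. By reflection, the mean
    of the digamma values at \<nu> and 1 - \<nu> is \<open>Digamma \<nu>\<close> plus the cotangent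
    term.\<close>
  have val: "ln pi + (- euler_mascheroni - Digamma (1 / 2)) -
      (- euler_mascheroni - (Digamma \<nu> + Digamma (1 - \<nu>)) / 2) =
      ln (4 * pi) - Digamma 1 + Digamma \<nu> + pi / 2 * cot (\<nu> * pi)"
  proof -
    have "\<nu> \<notin> \<int>"
      using assms by (auto elim!: Ints_cases)
    from Digamma_reflection_real[OF this] have "pi / 2 * cot (\<nu> * pi) = (Digamma (1 - \<nu>) - Digamma \<nu>) / 2"
      by (simp add: mult.commute)
    moreover have "ln (4 * pi) = 2 * ln 2 + ln pi"
      using ln_realpow[of 2 2] by (simp add: ln_mult)
    ultimately show ?thesis
      by (simp add: Digamma_one_half field_simps)
  qed
  show ?thesis
    using has_integral_eq[OF eq main] unfolding val .
qed

end
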